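(* Let $d\ge1$, let $\lambda=(\lambda_{J,\tau})$ be a complete signed tail family, and let $w$ be the coefficient system recovered from $\lambda$ by triangular inversion. Assume that $w_{I,\sigma}\ge 0$ for all $(I,\sigma)\in\mathcal G_d$ and that $\lambda_{\{i\},\mathrm L}=\lambda_{\{i\},\mathrm U}=1$ for $i=1,\dots,d$. Set $$S(w)=\sum_{(I,\sigma)\in\mathcal G_d}w_{I,\sigma},\qquad p_{\max}=\min\Bigl\{\tfrac12,\frac1{S(w)}\Bigr\}.$$ Then for every $p_0\in(0,p_{\max})$ there is a geometric witness copula $C$ at scale $p_0$ with $\lambda^{(p_0)}(C)=\lambda$. Moreover, if $1/S(w)<1/2$, the same holds for $p_0=p_{\max}$. By contrast, if $p_0\in(0,1/2)$ and $p_0>p_{\max}$, then no copula $C$ on $[0,1]^d$ (witness or otherwise) satisfies $\lambda^{(p_0)}(C)=\lambda$.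
   Context: Notation. $[d]=\{1,\dots,d\}$; $\mathcal G_d=\{(I,\sigma):\emptyset\ne I\subseteq[d],\ \sigma\in\{\mathrm L,\mathrm U\}^I\}$, where $\{\mathrm L,\mathrm U\}^I$ is the set of functions $I\to\{\mathrm L,\mathrm U\}$. A complete signed tail family is a real family $\lambda=(\lambda_{J,\tau})$ indexed by all $(J,\tau)\in\mathcal G_d$. Triangular inversion. The coefficient system $w=(w_{I,\sigma})_{(I,\sigma)\in\mathcal G_d}$ recovered from $\lambda$ is defined recursively, by descending $|I|$ from $d$ to $1$, by $w_{I,\sigma}=\lambda_{I,\sigma}-\sum_{K\supsetneq I}\sum_{\rho\in\{\mathrm L,\mathrm U\}^K:\,\rho|_I=\sigma}w_{K,\rho}$. Finite-threshold family of a copula. For $p\in(0,1/2)$ let $L_p=[0,p]$, $M_p=[p,1-p]$, $U_p=[1-p,1]$. For a copula $C$ and $U\sim C$, and $a\in\{\mathrm L,\mathrm M,\mathrm U\}^d$, let $q_a^{(p)}=\Pr(U\in B_a^{(p)})$, where $B_a^{(p)}$ is the product of the intervals $L_p$, $M_p$, $U_p$ chosen in coordinate $i$ according to $a_i=\mathrm L,\mathrm M,\mathrm U$ (a partition modulo null sets). For $(J,\tau)\in\mathcal G_d$, $\lambda^{(p)}_{J,\tau}(C)=\frac1p\sum_{a:\,a|_J=\tau}q_a^{(p)}$, and $\lambda^{(p)}(C)=(\lambda^{(p)}_{J,\tau}(C))$. Geometric witness copula at scale $p_0\in(0,1/2)$. For $(I,\sigma)\in\mathcal G_d$ let $\mu_{I,\sigma}^{(p_0)}$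 be the law of $(U_1,\dots,U_d)$ with $U_i=p_0Z$ if $i\in I,\sigma_i=\mathrm L$; $U_i=1-p_0Z$ if $i\in I,\sigma_i=\mathrm U$; $U_i=p_0+(1-2p_0)V_i$ if $i\notin I$, where $Z$ and the $V_i$ are independent and uniform on $[0,1]$. Let $\mu_0^{(p_0)}$ be the law of $(p_0+(1-2p_0)V_i)_{i=1}^d$ with $V_i$ i.i.d. uniform on $[0,1]$. For a nonnegative weight system $v=(v_{I,\sigma})_{(I,\sigma)\in\mathcal G_d}$ with $m_0=1-p_0\sum v_{I,\sigma}\ge0$, put $\mu^{(v,p_0)}=m_0\mu_0^{(p_0)}+\sum_{(I,\sigma)\in\mathcal G_d}p_0v_{I,\sigma}\,\mu_{I,\sigma}^{(p_0)}$. If $\mu^{(v,p_0)}$ has uniform one-dimensional margins, its distribution function $C^{(v,p_0)}$ is called a geometric witness copula at scale $p_0$. *)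

theory Defs
  imports "HOL-Probability.Probability"
begin

section \<open>Signed tail families and triangular inversion\<close>

text \<open>
  The constructors stand for the lower, middle and upper zones. A function on \<open>I \<subseteq> {1..d}\<close> is
  represented extensionally, as an element of \<open>I \<rightarrow>\<^sub>E X\<close>, so that \<open>restrict \<rho> I\<close> is the restriction
  to \<open>I\<close>. Families indexed by pairs \<open>(I, \<sigma>)\<close> are curried; only their values on \<open>signed_sets d\<close> matter.
\<close>

datatype zone = Lo | Mid | Up

abbreviation signs :: "nat set \<Rightarrow> (nat \<Rightarrow> zone) set" where
  "signs I \<equiv> I \<rightarrow>\<^sub>E {Lo, Up}"

definition signed_sets :: "nat \<Rightarrow> (nat set \<times> (nat \<Rightarrow> zone)) set" where
  "signed_sets d = (SIGMA I:{I. I \<noteq> {} \<and> I \<subseteq> {1..d}}. signs I)"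

type_synonym signed_family = "nat set \<Rightarrow> (nat \<Rightarrow> zone) \<Rightarrow> real"

function triangular_inversion :: "nat \<Rightarrow> signed_family \<Rightarrow> signed_family" where
  "triangular_inversion d lam I \<sigma> =
     lam I \<sigma> - (\<Sum>K | I \<subset> K \<and> K \<subseteq> {1..d}.
                 \<Sum>\<rho> | \<rho> \<in> signs K \<and> restrict \<rho> I = \<sigma>. triangular_inversion d lam K \<rho>)"
  by pat_completeness auto
termination
proof (relation "Wellfounded.measure (\<lambda>(d, lam, I, \<sigma>). card ({1..d} - I))", goal_cases)
  case (2 d lam I \<sigma> K \<rho>)
  then have "{1..d} - K \<subset> {1..d} - I" by blast
  then show ?case by (simp add: psubset_card_mono)
qed auto

declare triangular_inversion.simps [simp del]


section \<open>Copulas and their finite-threshold families\<close>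

abbreviation borel_cube :: "nat \<Rightarrow> (nat \<Rightarrow> real) measure" where
  "borel_cube d \<equiv> \<Pi>\<^sub>M i\<in>{1..d}. borel"

abbreviation unif01 :: "real measure" where
  "unif01 \<equiv> uniform_measure lborel {0..1}"

definition uniform_margins :: "nat \<Rightarrow> (nat \<Rightarrow> real) measure \<Rightarrow> bool" where
  "uniform_margins d \<mu> \<longleftrightarrow> (\<forall>i\<in>{1..d}. distr \<mu> borel (\<lambda>x. x i) = unif01)"

text \<open>
  A copula is a joint distribution function with uniform margins. It is regarded as a function on
  the unit cube, so nothing is required of its values elsewhere.
\<close>

definition is_law_of :: "nat \<Rightarrow> ((nat \<Rightarrow> real) \<Rightarrow> real) \<Rightarrow> (nat \<Rightarrow> real) measure \<Rightarrow> bool" where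
  "is_law_of d C \<mu> \<longleftrightarrow>
     prob_space \<mu> \<and> sets \<mu> = sets (borel_cube d) \<and> uniform_margins d \<mu> \<and>
     (\<forall>u \<in> {1..d} \<rightarrow>\<^sub>E {0..1}. C u = measure \<mu> {x \<in> space \<mu>. \<forall>i\<in>{1..d}. x i \<le> u i})"

definition copula :: "nat \<Rightarrow> ((nat \<Rightarrow> real) \<Rightarrow> real) \<Rightarrow> bool" where
  "copula d C \<longleftrightarrow> (\<exists>\<mu>. is_law_of d C \<mu>)"

lemma is_law_of_orthant:
  assumes "is_law_of d C \<mu>"
  shows "measure \<mu> (PiE {1..d} (\<lambda>i. {..u i})) =
    (if \<forall>i\<in>{1..d}. 0 \<le> u i then C (\<lambda>i\<in>{1..d}. min 1 (u i)) else 0)"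
proof -
  have prob: "prob_space \<mu>" and sets: "sets \<mu> = sets (borel_cube d)"
    and marg: "uniform_margins d \<mu>"
    and C: "\<And>u. u \<in> {1..d} \<rightarrow>\<^sub>E {0..1} \<Longrightarrow>
      C u = measure \<mu> {x \<in> space \<mu>. \<forall>i\<in>{1..d}. x i \<le> u i}"
    using assms by (auto simp: is_law_of_def)
  interpret prob_space \<mu> by fact
  have space: "space \<mu> = {1..d} \<rightarrow>\<^sub>E UNIV"
    using sets_eq_imp_space_eq[OF sets] by (simp add: space_PiM)
  have meas: "(\<lambda>x. x i) \<in> borel_measurable \<mu>" if "i \<in> {1..d}" for i
    using that measurable_component_singleton[of i "{1..d}" "\<lambda>_. borel"]
    by (simp add: measurable_cong_sets[OF sets refl])
  have box: "PiE {1..d} (\<lambda>i. {..u i}) \<in> sets \<mu>" for u :: "nat \<Rightarrow> real"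
    unfolding sets by (rule sets_PiM_I_finite) auto
  have AE01: "AE x in \<mu>. x i \<in> {0..1}" if "i \<in> {1..d}" for i
  proof -
    have "AE y in distr \<mu> borel (\<lambda>x. x i). y \<in> {0..1}"
    proof -
      have "AE y in unif01. y \<in> {0..1}" by (rule AE_uniform_measureI) auto
      moreover have "distr \<mu> borel (\<lambda>x. x i) = unif01"
        using that marg unfolding uniform_margins_def by blast
      ultimately show ?thesis by (simp only:)
    qed
    then show ?thesis
      using meas[OF that] by (simp add: AE_distr_iff)
  qed
  then have AE: "AE x in \<mu>. \<forall>i\<in>{1..d}. x i \<in> {0..1}"
    by (simp add: AE_ball_countable)
  show ?thesis
  proof (cases "\<forall>i\<in>{1..d}. 0 \<le> u i")
    case True
    define v where "v = (\<lambda>i\<in>{1..d}. min 1 (u i))"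
    have eq: "{x \<in> space \<mu>. \<forall>i\<in>{1..d}. x i \<le> v i} = PiE {1..d} (\<lambda>i. {..v i})"
      by (auto simp: space PiE_def Pi_def)
    have "measure \<mu> (PiE {1..d} (\<lambda>i. {..u i})) = measure \<mu> (PiE {1..d} (\<lambda>i. {..v i}))"
    proof (rule finite_measure_eq_AE)
      show "AE x in \<mu>. x \<in> PiE {1..d} (\<lambda>i. {..u i}) \<longleftrightarrow> x \<in> PiE {1..d} (\<lambda>i. {..v i})"
        using AE by eventually_elim (auto simp: PiE_def Pi_def v_def)
    qed (use box in auto)
    also have "\<dots> = C v"
      unfolding eq[symmetric] by (rule C[symmetric]) (use True in \<open>auto simp: v_def\<close>)
    finally show ?thesis using True by (simp add: v_def)
  next
    case False
    then obtain i where i: "i \<in> {1..d}" "u i < 0" by force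
    have "AE x in \<mu>. x \<notin> PiE {1..d} (\<lambda>i. {..u i})"
      using AE01[OF i(1)] by eventually_elim (use i in \<open>force simp: PiE_def Pi_def\<close>)
    then have "measure \<mu> (PiE {1..d} (\<lambda>i. {..u i})) = measure \<mu> {}"
      by (intro finite_measure_eq_AE) (use box in auto)
    then show ?thesis unfolding if_not_P[OF False] by simp
  qed
qed

lemma is_law_of_unique:
  assumes \<mu>: "is_law_of d C \<mu>" and \<nu>: "is_law_of d C \<nu>"
  shows "\<mu> = \<nu>"
proof -
  have sets: "sets \<mu> = sets (borel_cube d)" "sets \<nu> = sets (borel_cube d)"
    and prob: "prob_space \<mu>" "prob_space \<nu>"
    using assms by (auto simp: is_law_of_def)
  define F where "F = (\<lambda>u::nat \<Rightarrow> real. PiE {1..d} (\<lambda>i. {..u i}))"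
  let ?E = "range F" and ?\<Omega> = "{1..d} \<rightarrow>\<^sub>E (UNIV :: real set)"
  have gen: "sets (borel_cube d) = sigma_sets ?\<Omega> ?E"
  proof -
    let ?P = "{{f \<in> ?\<Omega>. \<forall>i\<in>j. f i \<in> A i} | A j.
      j \<in> {{1..d}} \<and> A \<in> Pi j (\<lambda>_. range (atMost :: real \<Rightarrow> _))}"
    have "\<exists>T\<subseteq>range (atMost :: real \<Rightarrow> _). countable T \<and> UNIV = \<Union>T"
      by (rule exI[of _ "range (\<lambda>n::nat. {..real n})"]) (auto intro: real_arch_simple)
    then have "sets (\<Pi>\<^sub>M i\<in>{1..d}. sigma UNIV (range (atMost :: real \<Rightarrow> _))) = sets (sigma ?\<Omega> ?P)"
      by (intro sets_PiM_sigma) auto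
    then have "sets (borel_cube d) = sets (sigma ?\<Omega> ?P)"
      by (simp add: borel_eq_atMost)
    also have "\<dots> = sigma_sets ?\<Omega> ?P"
      by (rule sets_measure_of) auto
    also have "?P = ?E"
    proof (intro equalityI subsetI)
      fix X assume "X \<in> ?P"
      then obtain A where A: "X = {f \<in> ?\<Omega>. \<forall>i\<in>{1..d}. f i \<in> A i}"
          "\<forall>i\<in>{1..d}. \<exists>u::real. A i = {..u}"
        by (auto simp: Pi_def image_def)
      from bchoice[OF A(2)] obtain u where "\<forall>i\<in>{1..d}. A i = {..u i}" by blast
      then have "X = F u" unfolding A(1) F_def by (auto simp: PiE_def Pi_def)
      then show "X \<in> ?E" by blast
    next
      fix X assume "X \<in> ?E"
      then obtain u where "X = F u" by blast
      then have "X = {f \<in> ?\<Omega>. \<forall>i\<in>{1..d}. f i \<in> {..u i}}"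
        by (auto simp: F_def PiE_def Pi_def)
      then show "X \<in> ?P"
        by (intro CollectI exI[of _ "\<lambda>i. {..u i}"] exI[of _ "{1..d}"] conjI) auto
    qed
    finally show ?thesis .
  qed
  show ?thesis
  proof (rule measure_eqI_generator_eq[where E = ?E and \<Omega> = ?\<Omega> and A = "\<lambda>n. F (\<lambda>_. real n)"])
    show "Int_stable ?E"
    proof (rule Int_stableI)
      fix a b assume "a \<in> ?E" "b \<in> ?E"
      then obtain u v where "a = F u" "b = F v" by blast
      then have "a \<inter> b = F (\<lambda>i. min (u i) (v i))"
        by (auto simp: F_def PiE_def Pi_def)
      then show "a \<inter> b \<in> ?E" by blast
    qed
    show "?E \<subseteq> Pow ?\<Omega>" by (auto simp: F_def PiE_def)
    show "emeasure \<mu> X = emeasure \<nu> X" if "X \<in> ?E" for X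
      using that is_law_of_orthant[OF \<mu>] is_law_of_orthant[OF \<nu>] prob
      by (auto simp: F_def finite_measure.emeasure_eq_measure prob_space.finite_measure)
    show "sets \<mu> = sigma_sets ?\<Omega> ?E" "sets \<nu> = sigma_sets ?\<Omega> ?E"
      using sets gen by auto
    show "range (\<lambda>n. F (\<lambda>_. real n)) \<subseteq> ?E" by blast
    show "(\<Union>n. F (\<lambda>_. real n)) = ?\<Omega>"
    proof (intro equalityI subsetI)
      fix x assume x: "x \<in> ?\<Omega>"
      obtain n where "Max (insert 0 (x ` {1..d})) \<le> real n" using real_arch_simple by blast
      then have "x \<in> F (\<lambda>_. real n)"
        using x by (auto simp: F_def PiE_def Pi_def)
      then show "x \<in> (\<Union>n. F (\<lambda>_. real n))" by blast
    qed (auto simp: F_def PiE_def)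
    show "emeasure \<mu> (F (\<lambda>_. real n)) \<noteq> \<infinity>" for n
      using prob by (simp add: finite_measure.emeasure_finite prob_space.finite_measure)
  qed
qed

definition copula_law :: "nat \<Rightarrow> ((nat \<Rightarrow> real) \<Rightarrow> real) \<Rightarrow> (nat \<Rightarrow> real) measure" where
  "copula_law d C = (THE \<mu>. is_law_of d C \<mu>)"

lemma copula_law_eq: "is_law_of d C \<mu> \<Longrightarrow> copula_law d C = \<mu>"
  unfolding copula_law_def by (rule the_equality) (auto intro: is_law_of_unique)

fun zone_interval :: "real \<Rightarrow> zone \<Rightarrow> real set" where
  "zone_interval p Lo = {0..p}"
| "zone_interval p Mid = {p..1 - p}"
| "zone_interval p Up = {1 - p..1}"

definition cell_prob :: "nat \<Rightarrow> real \<Rightarrow> ((nat \<Rightarrow> real) \<Rightarrow> real) \<Rightarrow> (nat \<Rightarrow> zone) \<Rightarrow> real" where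
  "cell_prob d p C a = measure (copula_law d C) (PiE {1..d} (\<lambda>i. zone_interval p (a i)))"

definition threshold_family :: "nat \<Rightarrow> real \<Rightarrow> ((nat \<Rightarrow> real) \<Rightarrow> real) \<Rightarrow> signed_family" where
  "threshold_family d p C J \<tau> =
     1 / p * (\<Sum>a | a \<in> {1..d} \<rightarrow>\<^sub>E {Lo, Mid, Up} \<and> restrict a J = \<tau>. cell_prob d p C a)"


section \<open>Geometric witness copulas\<close>

text \<open>
  The first factor of the product carries the common variable \<open>Z\<close>, the second one the \<open>V\<^sub>i\<close>; those
  with \<open>i \<in> I\<close> are not used.
\<close>

definition witness_component ::
    "nat \<Rightarrow> real \<Rightarrow> nat set \<Rightarrow> (nat \<Rightarrow> zone) \<Rightarrow> (nat \<Rightarrow> real) measure" where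
  "witness_component d p I \<sigma> =
     distr (unif01 \<Otimes>\<^sub>M (\<Pi>\<^sub>M i\<in>{1..d}. unif01)) (borel_cube d)
       (\<lambda>(z, v). \<lambda>i\<in>{1..d}.
          if i \<in> I then (if \<sigma> i = Lo then p * z else 1 - p * z)
          else p + (1 - 2 * p) * v i)"

definition witness_base :: "nat \<Rightarrow> real \<Rightarrow> (nat \<Rightarrow> real) measure" where
  "witness_base d p =
     distr (\<Pi>\<^sub>M i\<in>{1..d}. unif01) (borel_cube d) (\<lambda>v. \<lambda>i\<in>{1..d}. p + (1 - 2 * p) * v i)"

definition base_mass :: "nat \<Rightarrow> real \<Rightarrow> signed_family \<Rightarrow> real" where
  "base_mass d p v = 1 - p * (\<Sum>(I, \<sigma>)\<in>signed_sets d. v I \<sigma>)"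

definition witness_measure :: "nat \<Rightarrow> real \<Rightarrow> signed_family \<Rightarrow> (nat \<Rightarrow> real) measure" where
  "witness_measure d p v =
     measure_of (space (borel_cube d)) (sets (borel_cube d))
       (\<lambda>A. ennreal (base_mass d p v) * emeasure (witness_base d p) A +
            (\<Sum>(I, \<sigma>)\<in>signed_sets d. ennreal (p * v I \<sigma>) * emeasure (witness_component d p I \<sigma>) A))"

lemma sets_witness_measure [simp]: "sets (witness_measure d p v) = sets (borel_cube d)"
  unfolding witness_measure_def by (simp add: sets.space_closed sets.sigma_sets_eq)

lemma emeasure_witness_measure:
  assumes "A \<in> sets (borel_cube d)"
  shows "emeasure (witness_measure d p v) A =
    ennreal (base_mass d p v) * emeasure (witness_base d p) A +
    (\<Sum>(I, \<sigma>)\<in>signed_sets d. ennreal (p * v I \<sigma>) * emeasure (witness_component d p I \<sigma>) A)"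
  unfolding witness_measure_def
proof (rule emeasure_measure_of_sigma)
  show "sigma_algebra (space (borel_cube d)) (sets (borel_cube d))"
    by (rule sets.sigma_algebra_axioms)
  show "countably_additive (sets (borel_cube d))
    (\<lambda>A. ennreal (base_mass d p v) * emeasure (witness_base d p) A +
      (\<Sum>(I, \<sigma>)\<in>signed_sets d. ennreal (p * v I \<sigma>) * emeasure (witness_component d p I \<sigma>) A))"
  proof (rule countably_additiveI)
    fix A :: "nat \<Rightarrow> (nat \<Rightarrow> real) set"
    assume A: "range A \<subseteq> sets (borel_cube d)" "disjoint_family A"
    have base: "(\<Sum>n. emeasure (witness_base d p) (A n)) = emeasure (witness_base d p) (\<Union>n. A n)"
      using A by (intro suminf_emeasure) (auto simp: witness_base_def)
    have comp: "(\<Sum>n. emeasure (witness_component d p I \<sigma>) (A n)) =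
        emeasure (witness_component d p I \<sigma>) (\<Union>n. A n)" for I \<sigma>
      using A by (intro suminf_emeasure) (auto simp: witness_component_def)
    show "(\<Sum>n. ennreal (base_mass d p v) * emeasure (witness_base d p) (A n) +
        (\<Sum>(I, \<sigma>)\<in>signed_sets d.
          ennreal (p * v I \<sigma>) * emeasure (witness_component d p I \<sigma>) (A n))) =
      ennreal (base_mass d p v) * emeasure (witness_base d p) (\<Union>n. A n) +
      (\<Sum>(I, \<sigma>)\<in>signed_sets d.
        ennreal (p * v I \<sigma>) * emeasure (witness_component d p I \<sigma>) (\<Union>n. A n))"
      by (simp add: suminf_add[symmetric] suminf_sum case_prod_unfold base comp)
  qed
qed (use assms in \<open>auto simp: positive_def\<close>)

definition geometric_witness_copula :: "nat \<Rightarrow> real \<Rightarrow> ((nat \<Rightarrow> real) \<Rightarrow> real) \<Rightarrow> bool" where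
  "geometric_witness_copula d p C \<longleftrightarrow>
     (\<exists>v. (\<forall>(I, \<sigma>)\<in>signed_sets d. 0 \<le> v I \<sigma>) \<and> 0 \<le> base_mass d p v \<and>
          uniform_margins d (witness_measure d p v) \<and>
          (\<forall>u \<in> {1..d} \<rightarrow>\<^sub>E {0..1}. C u =
             measure (witness_measure d p v)
               {x \<in> space (witness_measure d p v). \<forall>i\<in>{1..d}. x i \<le> u i}))"

lemma geometric_witness_copula_imp_copula:
  assumes "d \<ge> 1" "geometric_witness_copula d p C"
  shows "copula d C"
proof -
  obtain v where marg: "uniform_margins d (witness_measure d p v)"
    and C: "\<forall>u \<in> {1..d} \<rightarrow>\<^sub>E {0..1}. C u = measure (witness_measure d p v)
      {x \<in> space (witness_measure d p v). \<forall>i\<in>{1..d}. x i \<le> u i}"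
    using assms(2) by (auto simp: geometric_witness_copula_def)
  have "1 \<in> {1..d}" using assms(1) by simp
  then have "(\<lambda>x. x 1) \<in> witness_measure d p v \<rightarrow>\<^sub>M (borel :: real measure)"
    using measurable_component_singleton[of 1 "{1..d}" "\<lambda>_. borel :: real measure"]
    by (simp add: measurable_cong_sets[OF sets_witness_measure refl])
  moreover have "distr (witness_measure d p v) borel (\<lambda>x. x 1) = unif01"
    using \<open>1 \<in> {1..d}\<close> marg unfolding uniform_margins_def by blast
  moreover have "prob_space unif01" by (rule prob_space_uniform_measure) auto
  ultimately have "prob_space (witness_measure d p v)"
    by (metis prob_space_distrD)
  then show ?thesis
    using marg C by (auto simp: copula_def is_law_of_def)
qed

end

theory Submission
  imports Defs
begin

text \<open>
  A signed set \<open>(K, \<rho>)\<close> is the same thing as a word in \<open>{Lo, Mid, Up}\<^sup>d\<close> other than the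
  all-middle word: write \<open>\<rho>\<close> on \<open>K\<close> and \<open>Mid\<close> elsewhere. Under this dictionary the words \<open>a\<close> with
  \<open>a|\<^sub>J = \<tau>\<close> become the signed sets \<open>(K, \<rho>)\<close> with \<open>J \<subseteq> K\<close> and \<open>\<rho>|\<^sub>J = \<tau>\<close>. So the definition of the
  threshold family of a copula expresses its values through the scaled cell probabilities
  \<open>q\<^sub>a / p\<close> by exactly the triangular system that defines \<open>w\<close> from \<open>\<lambda>\<close>. That system has only one
  solution, hence the threshold family of \<open>C\<close> at \<open>p\<close> is \<open>\<lambda>\<close> if and only if every cell that is not all-middle satisfies
  \<open>q\<^sub>a = p w\<^sub>a\<close> (\<open>threshold_family_eq_iff_cell_prob\<close>). What remains is to decide for which \<open>p\<close> a copula
  with these cell probabilities exists.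

  Necessity: the faces on which cells meet are null sets because the margins are uniform, so the
  cell probabilities add up to at most one (\<open>sum_cell_prob_le_1\<close>), and \<open>p S \<le> 1\<close> follows.

  Sufficiency: if \<open>p S \<le> 1\<close>, the witness with weights \<open>w\<close> has a nonnegative base mass. Each of its
  components is concentrated on the single cell given by its word, so the cell of \<open>(I, \<sigma>)\<close> receives
  exactly the mass \<open>p w\<^sub>I\<^sub>,\<^sub>\<sigma>\<close> (\<open>emeasure_witness_measure_cell\<close>). In coordinate \<open>i\<close> each component is
  uniform on one of the three zones. The components on the lower zone have total mass
  \<open>p\<close> times the value of \<open>\<lambda>\<close> at \<open>({i}, Lo)\<close>, which is \<open>p\<close>, those on the upper zone likewise \<open>p\<close>, and the remaining mass \<open>1 - 2 p\<close> lies on the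
  middle zone. Every zone thus carries its own length, and the margin is uniform
  (\<open>uniform_margins_witness_measure\<close>).

  The normalisation at one singleton already gives \<open>S \<ge> 1\<close>, so that \<open>p S \<le> 1\<close> means \<open>p \<le> 1 / S\<close>.
\<close>

(* keeps {1..d} from being rewritten to {Suc 0..d} *)
declare One_nat_def [simp del]

section \<open>Signed sets as zone words\<close>

lemma UNIV_zone: "(UNIV :: zone set) = {Lo, Mid, Up}"
  by (auto intro: zone.exhaust)

instance zone :: finite
  by standard (simp add: UNIV_zone)

definition word_of :: "nat \<Rightarrow> nat set \<Rightarrow> (nat \<Rightarrow> zone) \<Rightarrow> nat \<Rightarrow> zone" where
  "word_of d K \<rho> = (\<lambda>i\<in>{1..d}. if i \<in> K then \<rho> i else Mid)"

text \<open>
  The terms of the triangular equation at \<open>(J, \<tau>)\<close>, including the diagonal term \<open>(J, \<tau>)\<close> itself.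
\<close>

definition extensions :: "nat \<Rightarrow> nat set \<Rightarrow> (nat \<Rightarrow> zone) \<Rightarrow> (nat set \<times> (nat \<Rightarrow> zone)) set" where
  "extensions d J \<tau> = (SIGMA K:{K. J \<subseteq> K \<and> K \<subseteq> {1..d}}. {\<rho> \<in> signs K. restrict \<rho> J = \<tau>})"

lemma finite_signed_sets [simp]: "finite (signed_sets d)"
  unfolding signed_sets_def
  by (intro finite_SigmaI finite_PiE) (auto intro: finite_subset[of _ "{1..d}"])

lemma extensions_subset: "J \<noteq> {} \<Longrightarrow> extensions d J \<tau> \<subseteq> signed_sets d"
  by (auto simp: extensions_def signed_sets_def)

lemma finite_words [simp]: "finite ({1..d} \<rightarrow>\<^sub>E (A :: zone set))" for d :: nat
  by (rule finite_PiE) auto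

lemma word_of_in_words: "word_of d K \<rho> \<in> {1..d} \<rightarrow>\<^sub>E UNIV"
  by (auto simp: word_of_def)

text \<open>
  The letters other than \<open>Mid\<close> recover \<open>K\<close>, since signs are never \<open>Mid\<close>. The statement also covers
  \<open>K = {}\<close>, the all-middle word, which belongs to the base component of a witness.
\<close>

lemma word_of_inj:
  assumes "K \<subseteq> {1..d}" "\<rho> \<in> signs K" "K' \<subseteq> {1..d}" "\<rho>' \<in> signs K'"
    and eq: "word_of d K \<rho> = word_of d K' \<rho>'"
  shows "K = K' \<and> \<rho> = \<rho>'"
proof -
  have supp: "K = {i \<in> {1..d}. word_of d K \<rho> i \<noteq> Mid}" if "K \<subseteq> {1..d}" "\<rho> \<in> signs K" for K \<rho>
    using that by (fastforce simp: word_of_def PiE_def Pi_def)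
  have sgn: "\<rho> = restrict (word_of d K \<rho>) K" if "K \<subseteq> {1..d}" "\<rho> \<in> signs K" for K \<rho>
    using that by (intro ext) (auto simp: word_of_def restrict_def PiE_def extensional_def)
  have "K = K'" using supp[of K \<rho>] supp[of K' \<rho>'] assms by simp
  then show ?thesis using sgn[of K \<rho>] sgn[of K' \<rho>'] assms by metis
qed

lemma inj_on_word_of: "inj_on (\<lambda>(K, \<rho>). word_of d K \<rho>) (signed_sets d)"
  by (rule inj_onI) (clarsimp simp: signed_sets_def word_of_inj)

text \<open>
  As \<open>\<tau>\<close> avoids \<open>Mid\<close>, every word extending \<open>\<tau>\<close> has its support above \<open>J\<close>. This is what turns the sum
  over cells in a threshold family into a triangular sum over signed sets.
\<close>

lemma bij_betw_extensions_words:
  assumes "(J, \<tau>) \<in> signed_sets d"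
  shows "bij_betw (\<lambda>(K, \<rho>). word_of d K \<rho>) (extensions d J \<tau>)
    {a \<in> {1..d} \<rightarrow>\<^sub>E {Lo, Mid, Up}. restrict a J = \<tau>}"
proof (rule bij_betw_imageI)
  have J: "J \<noteq> {}" "J \<subseteq> {1..d}" "\<tau> \<in> signs J" using assms by (auto simp: signed_sets_def)
  show "inj_on (\<lambda>(K, \<rho>). word_of d K \<rho>) (extensions d J \<tau>)"
    using inj_on_word_of extensions_subset[OF J(1)] by (rule inj_on_subset)
  show "(\<lambda>(K, \<rho>). word_of d K \<rho>) ` extensions d J \<tau> =
    {a \<in> {1..d} \<rightarrow>\<^sub>E {Lo, Mid, Up}. restrict a J = \<tau>}" (is "?L = ?R")
  proof (intro equalityI subsetI)
    fix a assume "a \<in> ?L"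
    then obtain K \<rho> where K: "(K, \<rho>) \<in> extensions d J \<tau>" "a = word_of d K \<rho>" by auto
    then have "restrict a J = restrict \<rho> J"
      using J(2) by (intro restrict_ext) (auto simp: word_of_def extensions_def)
    then show "a \<in> ?R" using K word_of_in_words[of d K \<rho>]
      by (auto simp: extensions_def UNIV_zone)
  next
    fix a assume a: "a \<in> ?R"
    define K where "K = {i \<in> {1..d}. a i \<noteq> Mid}"
    have tau: "a j = \<tau> j" if "j \<in> J" for j using a that by (auto simp: restrict_def)
    have sub: "J \<subseteq> K" using J tau by (fastforce simp: K_def PiE_def Pi_def)
    have "restrict a K \<in> signs K"
      using a by (force simp: K_def PiE_def Pi_def)
    moreover have "restrict (restrict a K) J = \<tau>"
      using a sub by (simp add: Int_absorb1)
    moreover have "word_of d K (restrict a K) = a"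
      using a by (intro ext) (auto simp: word_of_def K_def PiE_def extensional_def)
    ultimately have "(K, restrict a K) \<in> extensions d J \<tau>" "a = word_of d K (restrict a K)"
      using sub by (auto simp: extensions_def K_def)
    then show "a \<in> ?L" by (force intro: image_eqI[where x = "(K, restrict a K)"])
  qed
qed

text \<open>
  Identifies the total weight that a witness puts on an outer zone in coordinate \<open>i\<close> with a
  triangular sum at a singleton.
\<close>

lemma signed_sets_with_letter:
  assumes "i \<in> {1..d}" "z \<in> {Lo, Up}"
  shows "{(K, \<rho>). (K, \<rho>) \<in> signed_sets d \<and> word_of d K \<rho> i = z} = extensions d {i} (\<lambda>_\<in>{i}. z)"
proof -
  have "restrict \<rho> {i} = (\<lambda>_\<in>{i}. z) \<longleftrightarrow> \<rho> i = z" for \<rho> :: "nat \<Rightarrow> zone"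
    by (auto simp: restrict_def fun_eq_iff)
  then show ?thesis using assms
    by (auto simp: extensions_def signed_sets_def word_of_def)
qed

section \<open>The triangular system\<close>

lemma sum_extensions_split:
  fixes x :: signed_family
  assumes "(J, \<tau>) \<in> signed_sets d"
  shows "(\<Sum>(K, \<rho>)\<in>extensions d J \<tau>. x K \<rho>) =
    x J \<tau> + (\<Sum>K | J \<subset> K \<and> K \<subseteq> {1..d}. \<Sum>\<rho> | \<rho> \<in> signs K \<and> restrict \<rho> J = \<tau>. x K \<rho>)"
proof -
  have J: "J \<subseteq> {1..d}" "\<tau> \<in> signs J" using assms by (auto simp: signed_sets_def)
  have fin: "finite {K. J \<subset> K \<and> K \<subseteq> {1..d}}" by (rule finite_subset[of _ "Pow {1..d}"]) auto
  have fin_signs: "finite {\<rho> \<in> signs K. restrict \<rho> J = \<tau>}" if "K \<subseteq> {1..d}" for K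
    using finite_PiE[of K "\<lambda>_. {Lo, Up}"] that finite_subset[of K "{1..d}"] by simp
  have top: "{\<rho> \<in> signs J. restrict \<rho> J = \<tau>} = {\<tau>}"
    using J(2) by (auto simp: PiE_def extensional_restrict)
  have "{K. J \<subseteq> K \<and> K \<subseteq> {1..d}} = insert J {K. J \<subset> K \<and> K \<subseteq> {1..d}}"
    using J(1) by auto
  then have "(\<Sum>(K, \<rho>)\<in>extensions d J \<tau>. x K \<rho>) =
      (\<Sum>K\<in>insert J {K. J \<subset> K \<and> K \<subseteq> {1..d}}. \<Sum>\<rho> | \<rho> \<in> signs K \<and> restrict \<rho> J = \<tau>. x K \<rho>)"
    unfolding extensions_def using fin fin_signs J(1) by (subst sum.Sigma[symmetric]) auto
  then show ?thesis using fin top by simp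
qed

lemma sum_extensions_triangular_inversion:
  assumes "(J, \<tau>) \<in> signed_sets d"
  shows "(\<Sum>(K, \<rho>)\<in>extensions d J \<tau>. triangular_inversion d lam K \<rho>) = lam J \<tau>"
  unfolding sum_extensions_split[OF assms]
  by (subst (1) triangular_inversion.simps) simp

text \<open>
  The system is unitriangular for inclusion: the equation at \<open>(I, \<sigma>)\<close> determines \<open>x\<^sub>I\<^sub>,\<^sub>\<sigma>\<close> from the
  values on larger sets.
\<close>

lemma triangular_inversion_unique:
  fixes x :: signed_family
  assumes sys: "\<And>J \<tau>. (J, \<tau>) \<in> signed_sets d \<Longrightarrow> (\<Sum>(K, \<rho>)\<in>extensions d J \<tau>. x K \<rho>) = lam J \<tau>"
    and "(I, \<sigma>) \<in> signed_sets d"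
  shows "x I \<sigma> = triangular_inversion d lam I \<sigma>"
  using assms(2)
proof (induction "card ({1..d} - I)" arbitrary: I \<sigma> rule: less_induct)
  case less
  have "x K \<rho> = triangular_inversion d lam K \<rho>"
    if "I \<subset> K" "K \<subseteq> {1..d}" "\<rho> \<in> signs K" for K \<rho>
  proof (rule less.hyps)
    from that have "{1..d} - K \<subset> {1..d} - I" by blast
    then show "card ({1..d} - K) < card ({1..d} - I)" by (simp add: psubset_card_mono)
    show "(K, \<rho>) \<in> signed_sets d" using that by (auto simp: signed_sets_def)
  qed
  then have "(\<Sum>K | I \<subset> K \<and> K \<subseteq> {1..d}. \<Sum>\<rho> | \<rho> \<in> signs K \<and> restrict \<rho> I = \<sigma>. x K \<rho>) =
    (\<Sum>K | I \<subset> K \<and> K \<subseteq> {1..d}. \<Sum>\<rho> | \<rho> \<in> signs K \<and> restrict \<rho> I = \<sigma>.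
      triangular_inversion d lam K \<rho>)"
    by (intro sum.cong refl) auto
  then show ?case
    using sys[OF less.prems] sum_extensions_triangular_inversion[OF less.prems, of lam]
    unfolding sum_extensions_split[OF less.prems] by linarith
qed

lemma threshold_family_eq_sum_extensions:
  assumes "(J, \<tau>) \<in> signed_sets d"
  shows "threshold_family d p C J \<tau> =
    (\<Sum>(K, \<rho>)\<in>extensions d J \<tau>. cell_prob d p C (word_of d K \<rho>) / p)"
proof -
  have "(\<Sum>a | a \<in> {1..d} \<rightarrow>\<^sub>E {Lo, Mid, Up} \<and> restrict a J = \<tau>. cell_prob d p C a) =
    (\<Sum>(K, \<rho>)\<in>extensions d J \<tau>. cell_prob d p C (word_of d K \<rho>))"
    using sum.reindex_bij_betw[OF bij_betw_extensions_words[OF assms], of "cell_prob d p C"]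
    by (simp add: case_prod_unfold)
  then show ?thesis
    by (simp add: threshold_family_def sum_divide_distrib case_prod_unfold)
qed

text \<open>
  The scaled cell probabilities solve the triangular system whose right-hand side is the threshold
  family, and \<open>w\<close> is the solution for \<open>\<lambda>\<close>; uniqueness and the bijection with words give the two
  directions.
\<close>

proposition threshold_family_eq_iff_cell_prob:
  assumes "p \<noteq> 0"
  shows "(\<forall>(J, \<tau>)\<in>signed_sets d. threshold_family d p C J \<tau> = lam J \<tau>) \<longleftrightarrow>
    (\<forall>(I, \<sigma>)\<in>signed_sets d. cell_prob d p C (word_of d I \<sigma>) = p * triangular_inversion d lam I \<sigma>)"
    (is "?L \<longleftrightarrow> ?R")
proof
  assume ?L
  then have "(\<Sum>(K, \<rho>)\<in>extensions d J \<tau>. cell_prob d p C (word_of d K \<rho>) / p) = lam J \<tau>"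
    if "(J, \<tau>) \<in> signed_sets d" for J \<tau>
    using that threshold_family_eq_sum_extensions[OF that] by fastforce
  from triangular_inversion_unique[OF this] have
    "cell_prob d p C (word_of d I \<sigma>) / p = triangular_inversion d lam I \<sigma>"
    if "(I, \<sigma>) \<in> signed_sets d" for I \<sigma>
    using that by blast
  then show ?R using assms by (fastforce simp: field_simps)
next
  assume R: ?R
  have "threshold_family d p C J \<tau> = lam J \<tau>" if J: "(J, \<tau>) \<in> signed_sets d" for J \<tau>
  proof -
    have "extensions d J \<tau> \<subseteq> signed_sets d"
      using J by (intro extensions_subset) (auto simp: signed_sets_def)
    then have "(\<Sum>(K, \<rho>)\<in>extensions d J \<tau>. cell_prob d p C (word_of d K \<rho>) / p) =
        (\<Sum>(K, \<rho>)\<in>extensions d J \<tau>. triangular_inversion d lam K \<rho>)"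
      using R assms by (intro sum.cong refl) force
    then show ?thesis
      by (simp add: threshold_family_eq_sum_extensions[OF J]
          sum_extensions_triangular_inversion[OF J])
  qed
  then show ?L by blast
qed

section \<open>Total mass of the cells of a copula\<close>

lemma AE_unif01:
  assumes "AE t in lborel. t \<in> {0..1} \<longrightarrow> P t"
  shows "AE t in unif01. P t"
  using assms by (intro AE_uniform_measureI) auto

text \<open>
  Transfers null sets of the unit interval to the copula; it makes the threshold hyperplanes null.
\<close>

lemma AE_uniform_margin:
  assumes sets: "sets \<mu> = sets (borel_cube d)" and marg: "uniform_margins d \<mu>"
    and i: "i \<in> {1..d}" and P: "AE t in unif01. P t"
  shows "AE x in \<mu>. P (x i)"
proof (rule AE_distrD[where f = "\<lambda>x. x i" and M' = borel])
  show "(\<lambda>x. x i) \<in> \<mu> \<rightarrow>\<^sub>M (borel :: real measure)"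
    using i measurable_component_singleton[of i "{1..d}" "\<lambda>_. borel"]
    by (simp add: measurable_cong_sets[OF sets refl])
  have "distr \<mu> borel (\<lambda>x. x i) = unif01" using marg i by (simp only: uniform_margins_def)
  then show "AE t in distr \<mu> borel (\<lambda>x. x i). P t" using P by (simp only:)
qed

lemma zone_interval_borel [measurable]: "zone_interval p z \<in> sets borel"
  by (cases z) auto

lemma cell_in_sets [measurable]:
  "PiE {1..d} (\<lambda>i. zone_interval p (a i)) \<in> sets (borel_cube d)"
  by (rule sets_PiM_I_finite) auto

lemma zone_unique:
  assumes "0 < p" "p < 1 / 2" "t \<noteq> p" "t \<noteq> 1 - p" "t \<in> zone_interval p z" "t \<in> zone_interval p z'"
  shows "z = z'"
  using assms by (cases z; cases z') auto

lemma sum_cell_prob_le_1: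
  assumes C: "copula d C" and p: "0 < p" "p < 1 / 2" and A: "A \<subseteq> {1..d} \<rightarrow>\<^sub>E UNIV"
  shows "(\<Sum>a\<in>A. cell_prob d p C a) \<le> 1"
proof -
  obtain \<mu> where \<mu>: "is_law_of d C \<mu>" using C by (auto simp: copula_def)
  then have sets: "sets \<mu> = sets (borel_cube d)" and marg: "uniform_margins d \<mu>"
    and "prob_space \<mu>" by (auto simp: is_law_of_def)
  interpret prob_space \<mu> by fact
  define B where "B a = PiE {1..d} (\<lambda>i. zone_interval p (a i))" for a
  \<comment> \<open>the cells without the threshold hyperplanes, which are null sets, are disjoint\<close>
  define B' where "B' a = B a \<inter> PiE {1..d} (\<lambda>_. - {p, 1 - p})" for a
  have sets_B: "B a \<in> events" for a unfolding sets B_def by measurable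
  have "PiE {1..d} (\<lambda>_. - {p, 1 - p}) \<in> events"
    unfolding sets by (rule sets_PiM_I_finite) auto
  then have sets_B': "B' a \<in> events" for a using sets_B by (auto simp: B'_def)
  have "AE x in \<mu>. \<forall>i\<in>{1..d}. x i \<notin> {p, 1 - p}"
  proof (rule AE_finite_allI)
    fix i assume i: "i \<in> {1..d}"
    have "AE t in unif01. t \<notin> {p, 1 - p}"
      using AE_lborel_singleton[of p] AE_lborel_singleton[of "1 - p"] by (intro AE_unif01) auto
    then show "AE x in \<mu>. x i \<notin> {p, 1 - p}" by (rule AE_uniform_margin[OF sets marg i])
  qed simp
  then have "prob (B a) = prob (B' a)" for a
    by (intro finite_measure_eq_AE sets_B sets_B', eventually_elim)
      (auto simp: B'_def B_def PiE_def Pi_def)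
  then have "(\<Sum>a\<in>A. cell_prob d p C a) = (\<Sum>a\<in>A. prob (B' a))"
    by (simp add: cell_prob_def copula_law_eq[OF \<mu>] B_def)
  also have "\<dots> = prob (\<Union>a\<in>A. B' a)"
  proof (rule finite_measure_finite_Union[symmetric])
    show "finite A" using A by (rule finite_subset) simp
    show "B' ` A \<subseteq> events" using sets_B' by auto
    show "disjoint_family_on B' A"
    proof (unfold disjoint_family_on_def, intro ballI impI, rule ccontr)
      fix a b assume ab: "a \<in> A" "b \<in> A" "a \<noteq> b" and "B' a \<inter> B' b \<noteq> {}"
      then obtain x where x: "x \<in> B' a" "x \<in> B' b" by blast
      have "a i = b i" if "i \<in> {1..d}" for i
        using x that zone_unique[OF p, of "x i" "a i" "b i"]
        by (auto simp: B'_def B_def PiE_def Pi_def)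
      then have "a = b" using ab A by (intro PiE_ext[of a "{1..d}" "\<lambda>_. UNIV" b]) auto
      then show False using ab by simp
    qed
  qed
  also have "\<dots> \<le> 1" by simp
  finally show ?thesis .
qed

section \<open>Cells and margins of the witness measure\<close>

text \<open>
  The affine image of \<open>[0, 1]\<close> onto a zone that occurs in the components; the upper zone is
  traversed downwards.
\<close>

fun zone_map :: "real \<Rightarrow> zone \<Rightarrow> real \<Rightarrow> real" where
  "zone_map p Lo t = p * t"
| "zone_map p Mid t = p + (1 - 2 * p) * t"
| "zone_map p Up t = 1 - p * t"

lemma zone_map_measurable [measurable]: "zone_map p z \<in> borel_measurable borel"
proof -
  have "zone_map p z = (case z of Lo \<Rightarrow> \<lambda>t. p * t | Mid \<Rightarrow> \<lambda>t. p + (1 - 2 * p) * t | Up \<Rightarrow> \<lambda>t. 1 - p * t)"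
    by (cases z) auto
  then show ?thesis by (cases z) simp_all
qed

fun zone_length :: "real \<Rightarrow> zone \<Rightarrow> real" where
  "zone_length p Mid = 1 - 2 * p"
| "zone_length p _ = p"

abbreviation zone_law :: "real \<Rightarrow> zone \<Rightarrow> real measure" where
  "zone_law p z \<equiv> distr unif01 borel (zone_map p z)"

lemma prob_space_unif01: "prob_space unif01"
  by (rule prob_space_uniform_measure) auto

lemma prob_space_unif01_PiM: "prob_space (\<Pi>\<^sub>M i\<in>{1..d}. unif01)" for d :: nat
  by (intro prob_space_PiM prob_space_unif01)

lemma distr_pair_snd:
  assumes "prob_space M" "prob_space N"
  shows "distr (M \<Otimes>\<^sub>M N) N snd = N"
proof (rule measure_eqI)
  interpret M: prob_space M by fact
  interpret N: prob_space N by fact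
  fix A assume "A \<in> sets (distr (M \<Otimes>\<^sub>M N) N snd)"
  then have A: "A \<in> sets N" by simp
  have "snd -` A \<inter> space (M \<Otimes>\<^sub>M N) = space M \<times> A"
    using sets.sets_into_space[OF A] by (auto simp: space_pair_measure)
  then show "emeasure (distr (M \<Otimes>\<^sub>M N) N snd) A = emeasure N A"
    using A by (simp add: emeasure_distr N.emeasure_pair_measure_Times M.emeasure_space_1)
qed simp

lemma sets_unif01_PiM: "sets (\<Pi>\<^sub>M i\<in>{1..d}. unif01) = sets (borel_cube d)" for d :: nat
  by (intro sets_PiM_cong) auto

text \<open>
  The base is the degenerate component with no geometric coordinate, so one computation of margins
  and cells serves both.
\<close>

lemma witness_base_eq_component: "witness_base d p = witness_component d p {} \<sigma>"
proof -
  let ?P = "\<Pi>\<^sub>M i\<in>{1..d}. unif01"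
  have [measurable]: "(\<lambda>v. \<lambda>i\<in>{1..d}. p + (1 - 2 * p) * v i) \<in> ?P \<rightarrow>\<^sub>M borel_cube d"
    by (subst measurable_cong_sets[OF sets_unif01_PiM refl]) measurable
  have "witness_base d p =
      distr (distr (unif01 \<Otimes>\<^sub>M ?P) ?P snd) (borel_cube d) (\<lambda>v. \<lambda>i\<in>{1..d}. p + (1 - 2 * p) * v i)"
    unfolding witness_base_def
    by (subst distr_pair_snd) (auto intro: prob_space_unif01 prob_space_unif01_PiM)
  also have "\<dots> = witness_component d p {} \<sigma>"
    unfolding witness_component_def
    by (subst distr_distr) (auto simp: comp_def case_prod_unfold)
  finally show ?thesis .
qed

lemma sets_witness_component [simp]: "sets (witness_component d p I \<sigma>) = sets (borel_cube d)"
  by (simp add: witness_component_def)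

lemma margin_witness_component:
  assumes i: "i \<in> {1..d}" and \<sigma>: "\<sigma> \<in> signs I"
  shows "distr (witness_component d p I \<sigma>) borel (\<lambda>x. x i) = zone_law p (word_of d I \<sigma> i)"
proof -
  let ?P = "\<Pi>\<^sub>M i\<in>{1..d}. unif01"
  let ?M = "unif01 \<Otimes>\<^sub>M ?P"
  let ?F = "\<lambda>(z, v). \<lambda>i\<in>{1..d}.
    if i \<in> I then (if \<sigma> i = Lo then p * z else 1 - p * z) else p + (1 - 2 * p) * v i"
  have "sets ?M = sets (borel \<Otimes>\<^sub>M borel_cube d)"
    using sets_unif01_PiM by (intro sets_pair_measure_cong) auto
  note M_cong = measurable_cong_sets[OF this refl]
  have F [measurable]: "?F \<in> ?M \<rightarrow>\<^sub>M borel_cube d"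
    unfolding M_cong by measurable
  have proj: "(\<lambda>x. x i) \<in> borel_cube d \<rightarrow>\<^sub>M (borel :: real measure)"
    using i by measurable
  have comp_Pi: "(\<lambda>v. v i) \<in> ?P \<rightarrow>\<^sub>M unif01" using i by measurable
  have zm: "zone_map p z \<in> unif01 \<rightarrow>\<^sub>M borel" for z
    by (simp add: measurable_cong_sets[of unif01 borel borel borel])
  have margin: "distr (witness_component d p I \<sigma>) borel (\<lambda>x. x i) = distr ?M borel (\<lambda>\<omega>. ?F \<omega> i)"
    unfolding witness_component_def using proj F by (subst distr_distr) (auto simp: comp_def)
  show ?thesis
  proof (cases "i \<in> I")
    case True
    have "(\<lambda>\<omega>. ?F \<omega> i) = zone_map p (\<sigma> i) \<circ> fst"
      using True i \<sigma> by (auto simp: fun_eq_iff PiE_def Pi_def)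
    then have "distr ?M borel (\<lambda>\<omega>. ?F \<omega> i) = distr (distr ?M unif01 fst) borel (zone_map p (\<sigma> i))"
      using zm by (subst distr_distr) auto
    also have "\<dots> = zone_law p (\<sigma> i)"
      by (simp add: prob_space.distr_pair_fst[OF prob_space_unif01_PiM])
    also have "\<sigma> i = word_of d I \<sigma> i" using True i by (simp add: word_of_def)
    finally show ?thesis unfolding margin .
  next
    case False
    have "(\<lambda>\<omega>. ?F \<omega> i) = zone_map p Mid \<circ> (\<lambda>v. v i) \<circ> snd"
      using False i by (auto simp: fun_eq_iff)
    then have "distr ?M borel (\<lambda>\<omega>. ?F \<omega> i) =
        distr (distr (distr ?M ?P snd) unif01 (\<lambda>v. v i)) borel (zone_map p Mid)"
      using zm comp_Pi by (simp add: distr_distr comp_assoc measurable_comp[OF measurable_snd])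
    also have "distr ?M ?P snd = ?P"
      by (rule distr_pair_snd[OF prob_space_unif01 prob_space_unif01_PiM])
    also have "distr ?P unif01 (\<lambda>v. v i) = unif01"
      using i by (intro distr_PiM_component prob_space_unif01)
    also have "Mid = word_of d I \<sigma> i" using False i by (simp add: word_of_def)
    finally show ?thesis unfolding margin .
  qed
qed

text \<open>
  Interior points of the unit interval are mapped to interior points of the zone, away from the
  thresholds, so the zone they hit is unambiguous.
\<close>

lemma zone_map_in_zone_interval_iff:
  assumes "0 < p" "p < 1 / 2" "0 < t" "t < 1"
  shows "zone_map p z t \<in> zone_interval p z' \<longleftrightarrow> z' = z"
proof -
  define s u where "s = p * t" and "u = (1 - 2 * p) * t"
  have "0 < s" "s < p" "0 < u" "u < 1 - 2 * p"
    using assms by (auto simp: s_def u_def)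
  moreover have "zone_map p z t = (case z of Lo \<Rightarrow> s | Mid \<Rightarrow> p + u | Up \<Rightarrow> 1 - s)"
    by (cases z) (auto simp: s_def u_def)
  ultimately show ?thesis using assms(1,2) by (cases z; cases z') auto
qed

text \<open>
  Although the coordinates in \<open>I\<close> all depend on the same variable, each coordinate almost surely lies
  in its prescribed zone by its margin alone. Finitely many almost sure events hold jointly, so the
  component is concentrated on the cell of its own word.
\<close>

lemma emeasure_witness_component_cell:
  assumes p: "0 < p" "p < 1 / 2" and \<sigma>: "\<sigma> \<in> signs I" and a: "a \<in> {1..d} \<rightarrow>\<^sub>E UNIV"
  shows "emeasure (witness_component d p I \<sigma>) (PiE {1..d} (\<lambda>i. zone_interval p (a i))) =
    of_bool (word_of d I \<sigma> = a)"
proof -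
  let ?W = "witness_component d p I \<sigma>" and ?B = "PiE {1..d} (\<lambda>i. zone_interval p (a i))"
  have space: "space ?W = {1..d} \<rightarrow>\<^sub>E UNIV"
    using sets_eq_imp_space_eq[OF sets_witness_component] by (simp add: space_PiM)
  have "prob_space ?W"
  proof -
    interpret A: prob_space "unif01" by (rule prob_space_unif01)
    interpret B: prob_space "\<Pi>\<^sub>M i\<in>{1..d}. unif01" by (rule prob_space_unif01_PiM)
    interpret AB: pair_prob_space "unif01" "\<Pi>\<^sub>M i\<in>{1..d}. unif01" ..
    have "sets (unif01 \<Otimes>\<^sub>M (\<Pi>\<^sub>M i\<in>{1..d}. unif01)) = sets (borel \<Otimes>\<^sub>M borel_cube d)"
      using sets_unif01_PiM by (intro sets_pair_measure_cong) auto
    note M_cong = measurable_cong_sets[OF this refl]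
    show ?thesis unfolding witness_component_def
      by (rule AB.prob_space_distr) (unfold M_cong, measurable)
  qed
  then interpret W: prob_space ?W .
  have "AE x in ?W. \<forall>i\<in>{1..d}. x i \<in> zone_interval p (a i) \<longleftrightarrow> a i = word_of d I \<sigma> i"
  proof (rule AE_finite_allI)
    fix i assume i: "i \<in> {1..d}"
    show "AE x in ?W. x i \<in> zone_interval p (a i) \<longleftrightarrow> a i = word_of d I \<sigma> i"
    proof (rule AE_distrD[where f = "\<lambda>x. x i" and M' = borel])
      show "(\<lambda>x. x i) \<in> ?W \<rightarrow>\<^sub>M (borel :: real measure)"
        using i measurable_component_singleton[of i "{1..d}" "\<lambda>_. borel"]
        by (simp add: measurable_cong_sets[OF sets_witness_component refl])
      have "AE t in unif01.
          zone_map p (word_of d I \<sigma> i) t \<in> zone_interval p (a i) \<longleftrightarrow> a i = word_of d I \<sigma> i"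
        using AE_lborel_singleton[of 0] AE_lborel_singleton[of 1]
        by (intro AE_unif01, eventually_elim) (auto intro!: zone_map_in_zone_interval_iff[OF p])
      then show "AE t in distr ?W borel (\<lambda>x. x i).
          t \<in> zone_interval p (a i) \<longleftrightarrow> a i = word_of d I \<sigma> i"
        unfolding margin_witness_component[OF i \<sigma>]
        by (subst AE_distr_iff) (auto simp: measurable_cong_sets[of unif01 borel borel borel])
    qed
  qed simp
  moreover have "AE x in ?W. x \<in> space ?W" by (rule AE_space)
  ultimately have AE: "AE x in ?W. x \<in> ?B \<longleftrightarrow> word_of d I \<sigma> = a"
  proof eventually_elim
    case (elim x)
    have "x \<in> ?B \<longleftrightarrow> (\<forall>i\<in>{1..d}. a i = word_of d I \<sigma> i)"
      using elim unfolding space by (auto simp: PiE_iff)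
    also have "\<dots> \<longleftrightarrow> word_of d I \<sigma> = a"
      using PiE_ext[OF word_of_in_words a, of I \<sigma>] by auto
    finally show ?case .
  qed
  have B: "?B \<in> sets ?W" by simp
  show ?thesis
  proof (cases "word_of d I \<sigma> = a")
    case True
    then show ?thesis using AE B by (simp add: W.emeasure_eq_1_AE)
  next
    case False
    then have "emeasure ?W ?B = emeasure ?W {}"
      using AE B by (intro emeasure_eq_AE) auto
    then show ?thesis using False by simp
  qed
qed


lemma sum_weights_with_word:
  fixes v :: signed_family
  assumes "\<forall>(I, \<sigma>)\<in>signed_sets d. 0 \<le> v I \<sigma>" "0 \<le> p" "(K, \<rho>) \<in> signed_sets d"
  shows "(\<Sum>(I, \<sigma>)\<in>signed_sets d. ennreal (p * v I \<sigma>) * of_bool (word_of d I \<sigma> = word_of d K \<rho>)) =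
    ennreal (p * v K \<rho>)"
proof -
  have "(\<Sum>(I, \<sigma>)\<in>signed_sets d. ennreal (p * v I \<sigma>) * of_bool (word_of d I \<sigma> = word_of d K \<rho>)) =
    (\<Sum>x\<in>signed_sets d. if x = (K, \<rho>) then ennreal (p * v K \<rho>) else 0)"
    using inj_onD[OF inj_on_word_of, of d _ "(K, \<rho>)"] assms(3)
    by (intro sum.cong refl) (auto split: prod.splits)
  then show ?thesis using assms(3) by simp
qed

lemma emeasure_witness_measure_cell:
  assumes p: "0 < p" "p < 1 / 2" and v: "\<forall>(I, \<sigma>)\<in>signed_sets d. 0 \<le> v I \<sigma>"
    and K: "(K, \<rho>) \<in> signed_sets d"
  shows "emeasure (witness_measure d p v) (PiE {1..d} (\<lambda>i. zone_interval p (word_of d K \<rho> i))) =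
    ennreal (p * v K \<rho>)"
proof -
  let ?B = "PiE {1..d} (\<lambda>i. zone_interval p (word_of d K \<rho> i))"
  have K': "K \<noteq> {}" "K \<subseteq> {1..d}" "\<rho> \<in> signs K" using K by (auto simp: signed_sets_def)
  have comp: "emeasure (witness_component d p I \<sigma>) ?B = of_bool (word_of d I \<sigma> = word_of d K \<rho>)"
    if "\<sigma> \<in> signs I" for I \<sigma>
    by (rule emeasure_witness_component_cell[OF p that word_of_in_words])
  have triv: "(\<lambda>_. undefined) \<in> signs {}" by simp
  have "word_of d {} (\<lambda>_. undefined) \<noteq> word_of d K \<rho>"
    using word_of_inj[OF _ triv K'(2,3)] K'(1) by auto
  then have "emeasure (witness_base d p) ?B = 0"
    unfolding witness_base_eq_component[of d p "\<lambda>_. undefined"] comp[OF triv] by simp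
  moreover have "(\<Sum>(I, \<sigma>)\<in>signed_sets d.
      ennreal (p * v I \<sigma>) * emeasure (witness_component d p I \<sigma>) ?B) =
    (\<Sum>(I, \<sigma>)\<in>signed_sets d.
      ennreal (p * v I \<sigma>) * of_bool (word_of d I \<sigma> = word_of d K \<rho>))"
    by (intro sum.cong refl) (auto simp: signed_sets_def comp)
  ultimately show ?thesis
    using sum_weights_with_word[OF v _ K] p by (simp add: emeasure_witness_measure)
qed

text \<open>
  An affine image of the uniform law has constant density, the reciprocal of the length of the zone.
  Therefore masses equal to the zone lengths glue to Lebesgue measure on \<open>[0, 1]\<close>.
\<close>

lemma scaled_zone_law:
  assumes p: "0 < p" "p < 1 / 2" and B: "B \<in> sets borel"
  shows "ennreal (zone_length p z) * emeasure (zone_law p z) B =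
    emeasure lborel (zone_interval p z \<inter> B)"
proof -
  define c where "c = (case z of Lo \<Rightarrow> p | Mid \<Rightarrow> 1 - 2 * p | Up \<Rightarrow> - p)"
  define s where "s = (case z of Lo \<Rightarrow> 0 | Mid \<Rightarrow> p | Up \<Rightarrow> 1)"
  have c: "c \<noteq> 0" "\<bar>c\<bar> = zone_length p z" using p by (auto simp: c_def split: zone.splits)
  have map_eq: "zone_map p z t = s + c * t" for t
    by (auto simp: c_def s_def split: zone.splits)
  have onto: "zone_map p z t \<in> zone_interval p z \<longleftrightarrow> t \<in> {0..1}" for t
  proof -
    have "0 \<le> p * t \<longleftrightarrow> 0 \<le> t" "p * t \<le> p \<longleftrightarrow> t \<le> 1"
      "0 \<le> (1 - 2 * p) * t \<longleftrightarrow> 0 \<le> t" "(1 - 2 * p) * t \<le> 1 - 2 * p \<longleftrightarrow> t \<le> 1"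
      using p by (auto simp: zero_le_mult_iff)
    then show ?thesis by (cases z) auto
  qed
  have zm: "zone_map p z \<in> unif01 \<rightarrow>\<^sub>M borel"
    by (simp add: measurable_cong_sets[of unif01 borel borel borel])
  have pre: "zone_map p z -` B \<in> sets borel"
    using measurable_sets[OF zone_map_measurable B, of p z] by simp
  have "emeasure lborel (zone_interval p z \<inter> B) =
      emeasure (density (distr lborel borel (\<lambda>t. s + c * t)) (\<lambda>_. ennreal \<bar>c\<bar>)) (zone_interval p z \<inter> B)"
    by (rule arg_cong[OF lborel_real_affine[OF c(1)]])
  also have "\<dots> = ennreal \<bar>c\<bar> * emeasure (distr lborel borel (\<lambda>t. s + c * t)) (zone_interval p z \<inter> B)"
    using B by (subst emeasure_density_const) auto
  also have "emeasure (distr lborel borel (\<lambda>t. s + c * t)) (zone_interval p z \<inter> B) =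
      emeasure lborel ({0..1} \<inter> zone_map p z -` B)"
    using B onto map_eq
    by (subst emeasure_distr) (auto intro!: arg_cong[where f = "emeasure lborel"])
  also have "\<dots> = emeasure (zone_law p z) B"
    using B pre zm by (simp add: emeasure_distr divide_ennreal_def)
  finally show ?thesis using c by simp
qed

lemma emeasure_zones:
  assumes p: "0 < p" "p < 1 / 2" and B: "B \<in> sets borel"
  shows "(\<Sum>z\<in>UNIV. emeasure lborel (zone_interval p z \<inter> B)) = emeasure lborel ({0..1} \<inter> B)"
proof -
  have AE: "AE t in lborel. t \<noteq> p \<and> t \<noteq> 1 - p"
    using AE_lborel_singleton[of p] AE_lborel_singleton[of "1 - p"] by eventually_elim auto
  have "(\<Sum>z\<in>UNIV. emeasure lborel (zone_interval p z \<inter> B)) =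
      (\<integral>\<^sup>+t. (\<Sum>z\<in>UNIV. indicator (zone_interval p z \<inter> B) t) \<partial>lborel)"
    using B by (subst nn_integral_sum) auto
  also have "\<dots> = (\<integral>\<^sup>+t. indicator ({0..1} \<inter> B) t \<partial>lborel)"
  proof (rule nn_integral_cong_AE, use AE in eventually_elim)
    case (elim t)
    have "(\<Sum>z\<in>UNIV. indicator (zone_interval p z \<inter> B) t :: ennreal) =
        indicator ({0..p} \<inter> B) t + indicator ({p..1 - p} \<inter> B) t + indicator ({1 - p..1} \<inter> B) t"
      by (simp add: UNIV_zone add_ac)
    also have "\<dots> = indicator ({0..1} \<inter> B) t"
      using elim p by (auto split: split_indicator)
    finally show ?case .
  qed
  finally show ?thesis using B by simp
qed

text \<open>
  The components are grouped by the zone that they occupy in coordinate \<open>i\<close>. By the assumption on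
  singletons each outer zone carries mass \<open>p\<close>, so all three masses equal the zone lengths, and the
  pieces of Lebesgue measure add up to the uniform law.
\<close>

lemma uniform_margins_witness_measure:
  fixes v :: signed_family
  assumes p: "0 < p" "p < 1 / 2" and v: "\<forall>(I, \<sigma>)\<in>signed_sets d. 0 \<le> v I \<sigma>"
    and base: "0 \<le> base_mass d p v"
    and unit: "\<And>i z. i \<in> {1..d} \<Longrightarrow> z \<in> {Lo, Up} \<Longrightarrow>
      (\<Sum>(I, \<sigma>)\<in>extensions d {i} (\<lambda>_\<in>{i}. z). v I \<sigma>) = 1"
  shows "uniform_margins d (witness_measure d p v)"
  unfolding uniform_margins_def
proof
  fix i assume i: "i \<in> {1..d}"
  let ?\<mu> = "witness_measure d p v" and ?G = "signed_sets d"
  define zn where "zn = (\<lambda>(I, \<sigma>). word_of d I \<sigma> i)"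
  define G where "G z = {x \<in> ?G. zn x = z}" for z
  define W where "W z = (\<Sum>(I, \<sigma>)\<in>G z. v I \<sigma>)" for z
  have W_nonneg: "0 \<le> W z" for z
    unfolding W_def by (rule sum_nonneg) (use v in \<open>auto simp: G_def\<close>)
  have sum_G: "(\<Sum>z\<in>UNIV. \<Sum>x\<in>G z. f x) = sum f ?G" for f :: "_ \<Rightarrow> 'a :: comm_monoid_add"
    unfolding G_def by (rule sum.group) auto
  have W_tail: "W z = 1" if "z \<in> {Lo, Up}" for z
  proof -
    have "G z = extensions d {i} (\<lambda>_\<in>{i}. z)"
      using signed_sets_with_letter[OF i that] by (auto simp: G_def zn_def)
    then show ?thesis using unit[OF i that] by (simp add: W_def)
  qed
  \<comment> \<open>the two tails take mass \<open>p\<close> each, so the middle zone is left with its length\<close>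
  have W_total: "base_mass d p v + p * W Mid = 1 - 2 * p"
  proof -
    have "(\<Sum>(I, \<sigma>)\<in>?G. v I \<sigma>) = W Lo + W Mid + W Up"
      using sum_G[of "\<lambda>(I, \<sigma>). v I \<sigma>"] by (simp add: UNIV_zone W_def)
    then show ?thesis
      using W_tail by (simp add: base_mass_def algebra_simps)
  qed
  have proj: "(\<lambda>x. x i) \<in> ?\<mu> \<rightarrow>\<^sub>M (borel :: real measure)"
    using i measurable_component_singleton[of i "{1..d}" "\<lambda>_. borel"]
    by (simp add: measurable_cong_sets[OF sets_witness_measure refl])
  show "distr ?\<mu> borel (\<lambda>x. x i) = unif01"
  proof (rule measure_eqI)
    fix B assume "B \<in> sets (distr ?\<mu> borel (\<lambda>x. x i))"
    then have B: "B \<in> sets borel" by simp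
    let ?X = "(\<lambda>x. x i) -` B \<inter> space ?\<mu>"
    let ?D = "\<lambda>z. emeasure (zone_law p z) B"
    have space: "space (witness_component d p I \<sigma>) = space ?\<mu>" for I \<sigma>
      by (rule sets_eq_imp_space_eq) simp
    have comp: "emeasure (witness_component d p I \<sigma>) ?X = ?D (word_of d I \<sigma> i)"
      if "\<sigma> \<in> signs I" for I \<sigma>
    proof -
      have "(\<lambda>x. x i) \<in> witness_component d p I \<sigma> \<rightarrow>\<^sub>M (borel :: real measure)"
        using i measurable_component_singleton[of i "{1..d}" "\<lambda>_. borel"]
        by (simp add: measurable_cong_sets[OF sets_witness_component refl])
      then have "emeasure (witness_component d p I \<sigma>) ?X =
          emeasure (distr (witness_component d p I \<sigma>) borel (\<lambda>x. x i)) B"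
        using B by (simp add: emeasure_distr space)
      then show ?thesis unfolding margin_witness_component[OF i that] .
    qed
    \<comment> \<open>the base is the component of the empty signed set, whose word is \<open>Mid\<close> everywhere\<close>
    have triv: "(\<lambda>_. undefined) \<in> signs {}" by simp
    have base_X: "emeasure (witness_base d p) ?X = ?D Mid"
      unfolding witness_base_eq_component[of d p "\<lambda>_. undefined"] comp[OF triv]
      using i by (simp add: word_of_def)
    have X: "?X \<in> sets (borel_cube d)" using measurable_sets[OF proj B] by simp
    have "emeasure (distr ?\<mu> borel (\<lambda>x. x i)) B = emeasure ?\<mu> ?X"
      using B proj by (simp add: emeasure_distr)
    also have "\<dots> = ennreal (base_mass d p v) * ?D Mid +
        (\<Sum>x\<in>?G. ennreal (p * (case x of (I, \<sigma>) \<Rightarrow> v I \<sigma>)) * ?D (zn x))"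
      unfolding emeasure_witness_measure[OF X] base_X
      by (intro arg_cong2[where f = plus] sum.cong refl)
        (auto simp: comp signed_sets_def zn_def)
    also have "(\<Sum>x\<in>?G. ennreal (p * (case x of (I, \<sigma>) \<Rightarrow> v I \<sigma>)) * ?D (zn x)) =
        (\<Sum>z\<in>UNIV. ennreal (p * W z) * ?D z)"
    proof -
      have "(\<Sum>x\<in>G z. ennreal (p * (case x of (I, \<sigma>) \<Rightarrow> v I \<sigma>)) * ?D (zn x)) =
          ennreal (p * W z) * ?D z" for z
      proof -
        have "(\<Sum>x\<in>G z. ennreal (p * (case x of (I, \<sigma>) \<Rightarrow> v I \<sigma>)) * ?D (zn x)) =
            (\<Sum>x\<in>G z. ennreal (p * (case x of (I, \<sigma>) \<Rightarrow> v I \<sigma>))) * ?D z"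
          unfolding sum_distrib_right by (intro sum.cong refl) (auto simp: G_def)
        also have "(\<Sum>x\<in>G z. ennreal (p * (case x of (I, \<sigma>) \<Rightarrow> v I \<sigma>))) = ennreal (p * W z)"
          unfolding W_def sum_distrib_left using v p
          by (intro sum_ennreal) (auto simp: G_def)
        finally show ?thesis .
      qed
      then show ?thesis unfolding sum_G[symmetric] by simp
    qed
    also have "ennreal (base_mass d p v) * ?D Mid + (\<Sum>z\<in>UNIV. ennreal (p * W z) * ?D z) =
        (ennreal (base_mass d p v) + ennreal (p * W Mid)) * ?D Mid +
          ennreal (p * W Lo) * ?D Lo + ennreal (p * W Up) * ?D Up"
      unfolding UNIV_zone by (simp add: distrib_right add_ac)
    also have "\<dots> = (\<Sum>z\<in>UNIV. ennreal (zone_length p z) * ?D z)"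
    proof -
      have "ennreal (base_mass d p v) + ennreal (p * W Mid) = ennreal (zone_length p Mid)"
        using W_nonneg[of Mid] base p W_total by (subst ennreal_plus[symmetric]) auto
      then show ?thesis by (simp add: UNIV_zone W_tail add_ac)
    qed
    also have "\<dots> = emeasure lborel ({0..1} \<inter> B)"
      by (simp only: scaled_zone_law[OF p B] emeasure_zones[OF p B])
    also have "\<dots> = emeasure unif01 B"
      using B by (simp add: divide_ennreal_def)
    finally show "emeasure (distr ?\<mu> borel (\<lambda>x. x i)) B = emeasure unif01 B" .
  qed simp
qed

proposition ex_geometric_witness_copula:
  fixes v :: signed_family
  assumes d: "d \<ge> 1" and p: "0 < p" "p < 1 / 2"
    and v: "\<forall>(I, \<sigma>)\<in>signed_sets d. 0 \<le> v I \<sigma>"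
    and base: "0 \<le> base_mass d p v"
    and unit: "\<And>i z. i \<in> {1..d} \<Longrightarrow> z \<in> {Lo, Up} \<Longrightarrow>
      (\<Sum>(I, \<sigma>)\<in>extensions d {i} (\<lambda>_\<in>{i}. z). v I \<sigma>) = 1"
  obtains C where "geometric_witness_copula d p C"
    and "\<forall>(I, \<sigma>)\<in>signed_sets d. cell_prob d p C (word_of d I \<sigma>) = p * v I \<sigma>"
proof -
  let ?\<mu> = "witness_measure d p v"
  define C where "C u = measure ?\<mu> {x \<in> space ?\<mu>. \<forall>i\<in>{1..d}. x i \<le> u i}" for u
  have marg: "uniform_margins d ?\<mu>"
    by (rule uniform_margins_witness_measure[OF p v base unit])
  have one: "1 \<in> {1..d}" using d by simp
  have "(\<lambda>x. x 1) \<in> ?\<mu> \<rightarrow>\<^sub>M (borel :: real measure)"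
    using one measurable_component_singleton[of 1 "{1..d}" "\<lambda>_. borel :: real measure"]
    by (simp add: measurable_cong_sets[OF sets_witness_measure refl])
  moreover have "distr ?\<mu> borel (\<lambda>x. x 1) = unif01"
    using one marg unfolding uniform_margins_def by blast
  ultimately have "prob_space ?\<mu>"
    using prob_space_unif01 by (metis prob_space_distrD)
  then have "is_law_of d C ?\<mu>"
    using marg by (simp add: is_law_of_def C_def)
  note law = copula_law_eq[OF this]
  show ?thesis
  proof
    show "geometric_witness_copula d p C"
      unfolding geometric_witness_copula_def using v base marg by (auto simp: C_def)
    have "cell_prob d p C (word_of d I \<sigma>) = p * v I \<sigma>" if "(I, \<sigma>) \<in> signed_sets d" for I \<sigma>
    proof -
      have "0 \<le> p * v I \<sigma>" using v p that by auto
      then show ?thesis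
        by (simp add: cell_prob_def law measure_def emeasure_witness_measure_cell[OF p v that])
    qed
    then show "\<forall>(I, \<sigma>)\<in>signed_sets d. cell_prob d p C (word_of d I \<sigma>) = p * v I \<sigma>" by blast
  qed
qed

section \<open>Realizable scales\<close>

theorem theorem3:
  fixes d :: nat and lam w :: signed_family and S pmax :: real
  assumes d: "d \<ge> 1"
    and w: "w = triangular_inversion d lam"
    and nonneg: "\<forall>(I, \<sigma>)\<in>signed_sets d. w I \<sigma> \<ge> 0"
    and singletons: "\<forall>i\<in>{1..d}. lam {i} (\<lambda>_\<in>{i}. Lo) = 1 \<and> lam {i} (\<lambda>_\<in>{i}. Up) = 1"
    and S: "S = (\<Sum>(I, \<sigma>)\<in>signed_sets d. w I \<sigma>)"
    and pmax: "pmax = min (1 / 2) (1 / S)"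
  shows "(\<forall>p0. 0 < p0 \<and> p0 < pmax \<longrightarrow>
            (\<exists>C. geometric_witness_copula d p0 C \<and>
                 (\<forall>(J, \<tau>)\<in>signed_sets d. threshold_family d p0 C J \<tau> = lam J \<tau>)))
       \<and> (1 / S < 1 / 2 \<longrightarrow>
            (\<exists>C. geometric_witness_copula d pmax C \<and>
                 (\<forall>(J, \<tau>)\<in>signed_sets d. threshold_family d pmax C J \<tau> = lam J \<tau>)))
       \<and> (\<forall>p0. 0 < p0 \<and> p0 < 1 / 2 \<and> pmax < p0 \<longrightarrow>
            \<not> (\<exists>C. copula d C \<and>
                   (\<forall>(J, \<tau>)\<in>signed_sets d. threshold_family d p0 C J \<tau> = lam J \<tau>)))"
proof -
  have unit: "(\<Sum>(I, \<sigma>)\<in>extensions d {i} (\<lambda>_\<in>{i}. z). w I \<sigma>) = 1"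
    if "i \<in> {1..d}" "z \<in> {Lo, Up}" for i z
  proof -
    have "({i}, \<lambda>_\<in>{i}. z) \<in> signed_sets d" using that by (auto simp: signed_sets_def)
    from sum_extensions_triangular_inversion[OF this, of lam] show ?thesis
      using that singletons by (auto simp: w)
  qed
  \<comment> \<open>\<open>S\<close> dominates the part of its sum that is fixed by the normalisation at coordinate 1\<close>
  have "S \<ge> 1"
  proof -
    have "(\<Sum>(I, \<sigma>)\<in>extensions d {1} (\<lambda>_\<in>{1}. Lo). w I \<sigma>) \<le> S"
      unfolding S using nonneg by (intro sum_mono2 extensions_subset) auto
    then show ?thesis using unit[of 1 Lo] d by simp
  qed
  have sufficient: "\<exists>C. geometric_witness_copula d p C \<and>
      (\<forall>(J, \<tau>)\<in>signed_sets d. threshold_family d p C J \<tau> = lam J \<tau>)"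
    if p: "0 < p" "p < 1 / 2" "p \<le> 1 / S" for p
  proof -
    have "p * S \<le> 1" using p(3) \<open>S \<ge> 1\<close> by (simp add: pos_le_divide_eq)
    then have base: "0 \<le> base_mass d p w" unfolding base_mass_def S by simp
    obtain C where C: "geometric_witness_copula d p C"
      "\<forall>(I, \<sigma>)\<in>signed_sets d. cell_prob d p C (word_of d I \<sigma>) = p * w I \<sigma>"
      by (rule ex_geometric_witness_copula[OF d p(1,2) nonneg base unit])
    have "p \<noteq> 0" using p(1) by simp
    from threshold_family_eq_iff_cell_prob[OF this, of d C lam] C(2)
    have "\<forall>(J, \<tau>)\<in>signed_sets d. threshold_family d p C J \<tau> = lam J \<tau>"
      unfolding w by (rule iffD2)
    with C(1) show ?thesis by blast
  qed
  have necessary: "p \<le> 1 / S"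
    if p: "0 < p" "p < 1 / 2" and C: "copula d C"
      "\<forall>(J, \<tau>)\<in>signed_sets d. threshold_family d p C J \<tau> = lam J \<tau>" for p C
  proof -
    have cells: "\<forall>(I, \<sigma>)\<in>signed_sets d. cell_prob d p C (word_of d I \<sigma>) = p * w I \<sigma>"
      unfolding w
      by (rule iffD1[OF threshold_family_eq_iff_cell_prob C(2)]) (use p(1) in simp)
    have "p * S = (\<Sum>(I, \<sigma>)\<in>signed_sets d. cell_prob d p C (word_of d I \<sigma>))"
      unfolding S sum_distrib_left by (intro sum.cong refl) (use cells in fastforce)
    also have "\<dots> = (\<Sum>a\<in>(\<lambda>(I, \<sigma>). word_of d I \<sigma>) ` signed_sets d. cell_prob d p C a)"
      by (subst sum.reindex[OF inj_on_word_of]) (simp add: case_prod_unfold)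
    also have "\<dots> \<le> 1"
      by (intro sum_cell_prob_le_1[OF C(1) p] image_subsetI)
        (simp add: case_prod_unfold word_of_in_words)
    finally show ?thesis using \<open>S \<ge> 1\<close> by (simp add: pos_le_divide_eq)
  qed
  show ?thesis
  proof (intro conjI allI impI notI)
    fix p0 assume "0 < p0 \<and> p0 < pmax"
    then have "0 < p0" "p0 < 1 / 2" "p0 \<le> 1 / S" unfolding pmax by auto
    then show "\<exists>C. geometric_witness_copula d p0 C \<and>
        (\<forall>(J, \<tau>)\<in>signed_sets d. threshold_family d p0 C J \<tau> = lam J \<tau>)"
      by (rule sufficient)
  next
    assume "1 / S < 1 / 2"
    then have "0 < pmax" "pmax < 1 / 2" "pmax \<le> 1 / S" using \<open>S \<ge> 1\<close> unfolding pmax by auto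
    then show "\<exists>C. geometric_witness_copula d pmax C \<and>
        (\<forall>(J, \<tau>)\<in>signed_sets d. threshold_family d pmax C J \<tau> = lam J \<tau>)"
      by (rule sufficient)
  next
    fix p0 assume "0 < p0 \<and> p0 < 1 / 2 \<and> pmax < p0"
    then have p0: "0 < p0" "p0 < 1 / 2" "\<not> p0 \<le> 1 / S" unfolding pmax by auto
    assume "\<exists>C. copula d C \<and>
        (\<forall>(J, \<tau>)\<in>signed_sets d. threshold_family d p0 C J \<tau> = lam J \<tau>)"
    then obtain C where "copula d C"
      "\<forall>(J, \<tau>)\<in>signed_sets d. threshold_family d p0 C J \<tau> = lam J \<tau>" by (elim exE conjE)
    from necessary[OF p0(1,2) this] p0(3) show False by contradiction
  qed
qed

end
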